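(* Let $F$ be a field of characteristic zero and let $n\ge 1$. Then the Hamiltonian Lie algebra $H_{2n}$ is a proper Lie subalgebra of the special type Lie algebra $S_{2n}$.
   Context: $W(2n)$ is the Lie algebra of vector fields $\sum_{i=1}^{2n}f_i\,\partial/\partial x_i$ with $f_i\in F[x_1,\dots,x_{2n}]$, under the commutator bracket. $H_{2n}$ is the Lie subalgebra of $W(2n)$ generated by the elements $$-\sum_{i=1}^n\frac{\partial u}{\partial x_{n+i}}\frac{\partial}{\partial x_i}+\sum_{i=1}^n\frac{\partial u}{\partial x_i}\frac{\partial}{\partial x_{n+i}},\qquad u\in F[x_1,\dots,x_{2n}].$$ It is isomorphic to the Poisson Lie algebra of polynomials in $2n$ variables modulo constants. $S_{2n}$ is the special type Lie algebra, consisting of the divergence-free vector fields in $W(2n)$, i.e. those $\sum_{i=1}^{2n} f_i\,\partial/\partial x_i$ with $\sum_{i=1}^{2n}\partial f_i/\partial x_i=0$.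
   Formalization: The subalgebra claim is proved for all n ≥ 1, but properness only for n ≥ 2, since for n = 1 every divergence-free polynomial vector field in two variables is Hamiltonian, so H_2 = S_2. *)

theory Defs
  imports Complex_Main "HOL-Library.Poly_Mapping" "HOL-Library.Function_Algebras"
begin

text \<open>Polynomials are finitely supported coefficient functions on exponent vectors
  \<open>nat \<Rightarrow>\<^sub>0 nat\<close>; the exponent of the variable \<open>x\<^sub>i\<close> in \<open>m\<close> is \<open>lookup m i\<close>.\<close>

type_synonym 'a mpoly = "(nat \<Rightarrow>\<^sub>0 nat) \<Rightarrow>\<^sub>0 'a"

definition poly_ring :: "nat \<Rightarrow> 'a::comm_ring_1 mpoly set"
  where "poly_ring N = {p. \<forall>m\<in>Poly_Mapping.keys p. Poly_Mapping.keys m \<subseteq> {1..N}}"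

definition pd :: "nat \<Rightarrow> 'a::comm_ring_1 mpoly \<Rightarrow> 'a mpoly"
  where "pd i p = (\<Sum>m\<in>Poly_Mapping.keys p.
           Poly_Mapping.single (m - Poly_Mapping.single i 1) (of_nat (Poly_Mapping.lookup m i) * Poly_Mapping.lookup p m))"

text \<open>A family \<open>X\<close> of coefficients represents the vector field
  \<open>\<Sum>i=1..N. X i * \<partial>/\<partial>x\<^sub>i\<close>; the entries \<open>X i\<close> with \<open>i\<close> outside \<open>{1..N}\<close> are required to vanish.\<close>

type_synonym 'a vfield = "nat \<Rightarrow> 'a mpoly"

definition vf_apply :: "nat \<Rightarrow> 'a::comm_ring_1 vfield \<Rightarrow> 'a mpoly \<Rightarrow> 'a mpoly"
  where "vf_apply N X p = (\<Sum>i = 1..N. X i * pd i p)"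

definition vf_scale :: "'a::comm_ring_1 \<Rightarrow> 'a vfield \<Rightarrow> 'a vfield"
  where "vf_scale c X = (\<lambda>i. Poly_Mapping.single 0 c * X i)"

text \<open>The commutator of two vector fields in coordinates; lemma \<open>vf_apply_bracket\<close> below
  shows that it acts on polynomials as the commutator of the two derivations.\<close>

definition vf_bracket :: "nat \<Rightarrow> 'a::comm_ring_1 vfield \<Rightarrow> 'a vfield \<Rightarrow> 'a vfield"
  where "vf_bracket N X Y = (\<lambda>j. vf_apply N X (Y j) - vf_apply N Y (X j))"

global_interpretation vf: vector_space "vf_scale :: 'a::field \<Rightarrow> 'a vfield \<Rightarrow> 'a vfield"
  by unfold_locales
    (simp_all add: vf_scale_def fun_eq_iff distrib_left distrib_right single_add mult_single
      flip: mult.assoc)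

definition witt_alg :: "nat \<Rightarrow> 'a::field vfield set"
  where "witt_alg N = {X. \<forall>i. X i \<in> poly_ring N \<and> (i \<notin> {1..N} \<longrightarrow> X i = 0)}"

definition lie_algebra :: "nat \<Rightarrow> 'a::field vfield set \<Rightarrow> bool"
  where "lie_algebra N L \<longleftrightarrow> L \<subseteq> witt_alg N \<and> vf.subspace L \<and> (\<forall>X\<in>L. \<forall>Y\<in>L. vf_bracket N X Y \<in> L)"

definition lie_subalgebra :: "nat \<Rightarrow> 'a::field vfield set \<Rightarrow> 'a vfield set \<Rightarrow> bool"
  where "lie_subalgebra N K L \<longleftrightarrow> lie_algebra N K \<and> lie_algebra N L \<and> K \<subseteq> L"

definition ham_field :: "nat \<Rightarrow> 'a::field mpoly \<Rightarrow> 'a vfield"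
  where "ham_field n u = (\<lambda>i. if i \<in> {1..n} then - pd (n + i) u
                             else if i \<in> {n+1..2*n} then pd (i - n) u else 0)"

text \<open>\<open>special_alg (2 * n)\<close> is \<open>S\<close> in \<open>2 * n\<close> variables, \<open>hamiltonian_alg n\<close> is \<open>H\<close> in
  \<open>2 * n\<close> variables. The hull is the intersection of all Lie subalgebras of the algebra of vector
  fields that contain the generators.\<close>

definition special_alg :: "nat \<Rightarrow> 'a::field vfield set"
  where "special_alg N = {X \<in> witt_alg N. (\<Sum>i = 1..N. pd i (X i)) = 0}"

definition hamiltonian_alg :: "nat \<Rightarrow> 'a::field vfield set"
  where "hamiltonian_alg n =
    (\<lambda>K. lie_subalgebra (2*n) K (witt_alg (2*n))) hull (ham_field n ` poly_ring (2*n))"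

lemma lookup_pd:
  "Poly_Mapping.lookup (pd i p) m = of_nat (Poly_Mapping.lookup m i + 1) * Poly_Mapping.lookup p (m + Poly_Mapping.single i 1)"
proof -
  let ?e = "Poly_Mapping.single i (1::nat)"
  have "Poly_Mapping.lookup (pd i p) m =
      (\<Sum>k\<in>Poly_Mapping.keys p. if k - ?e = m then of_nat (Poly_Mapping.lookup k i) * Poly_Mapping.lookup p k else 0)"
    unfolding pd_def lookup_sum lookup_single when_def by simp
  also have "\<dots> = (\<Sum>k\<in>Poly_Mapping.keys p. if k = m + ?e then of_nat (Poly_Mapping.lookup k i) * Poly_Mapping.lookup p k else 0)"
  proof (rule sum.cong[OF refl])
    fix k
    have "k - ?e = m \<longleftrightarrow> k = m + ?e" if "Poly_Mapping.lookup k i \<noteq> 0"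
    proof -
      have "k - ?e + ?e = k"
        using that by (intro poly_mapping_eqI) (auto simp: lookup_add lookup_minus lookup_single when_def)
      then show ?thesis by (metis add_diff_cancel_right')
    qed
    then show "(if k - ?e = m then of_nat (Poly_Mapping.lookup k i) * Poly_Mapping.lookup p k else 0) =
        (if k = m + ?e then of_nat (Poly_Mapping.lookup k i) * Poly_Mapping.lookup p k else 0)"
      by (cases "Poly_Mapping.lookup k i = 0") (simp_all only: if_cancel of_nat_0 mult_zero_left not_False_eq_True)
  qed
  also have "\<dots> = of_nat (Poly_Mapping.lookup (m + ?e) i) * Poly_Mapping.lookup p (m + ?e)"
    by (simp add: sum.delta' in_keys_iff)
  finally show ?thesis by (simp add: lookup_add)
qed

lemma pd_zero [simp]: "pd i 0 = 0"
  by (simp add: pd_def)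

lemma pd_add: "pd i (p + q) = pd i p + pd i q"
  by (rule poly_mapping_eqI) (simp add: lookup_pd lookup_add algebra_simps)

lemma pd_diff: "pd i (p - q) = pd i p - pd i q"
  by (rule poly_mapping_eqI) (simp add: lookup_pd lookup_minus algebra_simps)

lemma pd_sum: "pd i (\<Sum>x\<in>A. f x) = (\<Sum>x\<in>A. pd i (f x))"
  by (induction A rule: infinite_finite_induct) (simp_all add: pd_add)

lemma pd_commute: "pd i (pd j p) = pd j (pd i p)"
proof (cases "i = j")
  case False
  then show ?thesis
    by (intro poly_mapping_eqI)
      (simp add: lookup_pd lookup_add lookup_single add.assoc
        add.commute[of "Poly_Mapping.single i _"] mult.left_commute)
qed simp

lemma pd_single:
  "pd i (Poly_Mapping.single m c) =
   Poly_Mapping.single (m - Poly_Mapping.single i 1) (of_nat (Poly_Mapping.lookup m i) * c)"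
  by (simp add: pd_def)

lemma pd_mult_single:
  "pd i (Poly_Mapping.single m c * Poly_Mapping.single k d) =
   pd i (Poly_Mapping.single m c) * Poly_Mapping.single k d +
   Poly_Mapping.single m c * pd i (Poly_Mapping.single k d)"
proof -
  let ?e = "Poly_Mapping.single i (1::nat)"
  have 1: "Poly_Mapping.lookup m i \<noteq> 0 \<Longrightarrow> m - ?e + k = m + k - ?e" for m k :: "nat \<Rightarrow>\<^sub>0 nat"
    by (rule poly_mapping_eqI) (auto simp: lookup_add lookup_minus lookup_single when_def)
  have A: "Poly_Mapping.single (m - ?e + k) (of_nat (Poly_Mapping.lookup m i) * c * d) =
      Poly_Mapping.single (m + k - ?e) (of_nat (Poly_Mapping.lookup m i) * c * d)"
    using 1[of m k] by (cases "Poly_Mapping.lookup m i = 0") auto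
  have B: "Poly_Mapping.single (m + (k - ?e)) (c * (of_nat (Poly_Mapping.lookup k i) * d)) =
      Poly_Mapping.single (m + k - ?e) (c * (of_nat (Poly_Mapping.lookup k i) * d))"
    using 1[of k m] by (cases "Poly_Mapping.lookup k i = 0") (auto simp: add.commute)
  show ?thesis
    unfolding pd_single mult_single A B lookup_add single_add[symmetric]
    by (rule arg_cong[where f = "Poly_Mapping.single _"]) (simp add: algebra_simps)
qed

lemma sum_monomials: "p = (\<Sum>m\<in>Poly_Mapping.keys p. Poly_Mapping.single m (Poly_Mapping.lookup p m))"
  by (rule poly_mapping_eqI)
    (auto simp: lookup_sum lookup_single when_def sum.delta in_keys_iff)

lemma pd_mult: "pd i (p * q) = pd i p * q + p * pd i q"
proof -
  define P Q where "P m = Poly_Mapping.single m (Poly_Mapping.lookup p m)"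
    and "Q m = Poly_Mapping.single m (Poly_Mapping.lookup q m)" for m
  have p: "p = sum P (Poly_Mapping.keys p)" and q: "q = sum Q (Poly_Mapping.keys q)"
    unfolding P_def Q_def by (rule sum_monomials)+
  have "pd i (sum P A * sum Q B) = pd i (sum P A) * sum Q B + sum P A * pd i (sum Q B)" for A B
    unfolding sum_product pd_sum
    by (simp add: P_def Q_def pd_mult_single sum.distrib)
  from this[of "Poly_Mapping.keys p" "Poly_Mapping.keys q"] show ?thesis
    by (simp only: p[symmetric] q[symmetric])
qed

lemma vf_apply_bracket:
  "vf_apply N (vf_bracket N X Y) p = vf_apply N X (vf_apply N Y p) - vf_apply N Y (vf_apply N X p)"
proof -
  have *: "vf_apply N X (vf_apply N Y p) =
      (\<Sum>j = 1..N. vf_apply N X (Y j) * pd j p) +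
      (\<Sum>i = 1..N. \<Sum>j = 1..N. X i * Y j * pd i (pd j p))" for X Y
  proof -
    have "vf_apply N X (vf_apply N Y p) =
        (\<Sum>i = 1..N. \<Sum>j = 1..N. X i * pd i (Y j) * pd j p) +
        (\<Sum>i = 1..N. \<Sum>j = 1..N. X i * Y j * pd i (pd j p))"
      by (simp add: vf_apply_def pd_sum pd_mult sum_distrib_left sum.distrib algebra_simps)
    also have "(\<Sum>i = 1..N. \<Sum>j = 1..N. X i * pd i (Y j) * pd j p) =
        (\<Sum>j = 1..N. vf_apply N X (Y j) * pd j p)"
      by (subst sum.swap) (simp add: vf_apply_def sum_distrib_right)
    finally show ?thesis .
  qed
  have "(\<Sum>i = 1..N. \<Sum>j = 1..N. X i * Y j * pd i (pd j p)) =
      (\<Sum>i = 1..N. \<Sum>j = 1..N. Y i * X j * pd i (pd j p))"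
    by (subst sum.swap) (simp add: pd_commute mult.commute)
  moreover have "vf_apply N (vf_bracket N X Y) p =
      (\<Sum>j = 1..N. vf_apply N X (Y j) * pd j p) - (\<Sum>j = 1..N. vf_apply N Y (X j) * pd j p)"
    by (subst vf_apply_def) (simp add: vf_bracket_def left_diff_distrib sum_subtractf)
  ultimately show ?thesis
    unfolding *[of X Y] *[of Y X] by simp
qed

lemma poly_ring_altdef: "p \<in> poly_ring N \<longleftrightarrow> (\<forall>m. Poly_Mapping.lookup p m \<noteq> 0 \<longrightarrow> Poly_Mapping.keys m \<subseteq> {1..N})"
  by (auto simp: poly_ring_def in_keys_iff)

lemma poly_ring_zero: "0 \<in> poly_ring N"
  by (simp add: poly_ring_def)

lemma poly_ring_add: "p \<in> poly_ring N \<Longrightarrow> q \<in> poly_ring N \<Longrightarrow> p + q \<in> poly_ring N"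
  using keys_add[of p q] unfolding poly_ring_def by blast

lemma poly_ring_diff: "p \<in> poly_ring N \<Longrightarrow> q \<in> poly_ring N \<Longrightarrow> p - q \<in> poly_ring N"
  using keys_diff[of p q] unfolding poly_ring_def by blast

lemma poly_ring_mult:
  assumes "p \<in> poly_ring N" "q \<in> poly_ring N"
  shows "p * q \<in> poly_ring N"
  unfolding poly_ring_def
proof (intro CollectI ballI)
  fix m assume "m \<in> Poly_Mapping.keys (p * q)"
  then obtain a b where m: "m = a + b" "a \<in> Poly_Mapping.keys p" "b \<in> Poly_Mapping.keys q"
    using keys_mult by blast
  then have "Poly_Mapping.keys a \<union> Poly_Mapping.keys b \<subseteq> {1..N}"
    using assms by (auto simp: poly_ring_def)
  then show "Poly_Mapping.keys m \<subseteq> {1..N}"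
    using keys_add[of a b] m by blast
qed

lemma poly_ring_const: "Poly_Mapping.single 0 c \<in> poly_ring N"
  by (simp add: poly_ring_def)

lemma poly_ring_sum: "(\<And>x. x \<in> A \<Longrightarrow> f x \<in> poly_ring N) \<Longrightarrow> sum f A \<in> poly_ring N"
  by (induction A rule: infinite_finite_induct) (simp_all add: poly_ring_zero poly_ring_add)

lemma poly_ring_pd:
  assumes "p \<in> poly_ring N"
  shows "pd i p \<in> poly_ring N"
  unfolding poly_ring_altdef
proof (intro allI impI)
  fix m assume "Poly_Mapping.lookup (pd i p) m \<noteq> 0"
  then have "Poly_Mapping.lookup p (m + Poly_Mapping.single i 1) \<noteq> 0"
    by (auto simp: lookup_pd)
  then have "Poly_Mapping.keys (m + Poly_Mapping.single i 1) \<subseteq> {1..N}"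
    using assms by (auto simp: poly_ring_altdef)
  moreover have "Poly_Mapping.keys m \<subseteq> Poly_Mapping.keys (m + Poly_Mapping.single i (1::nat))"
    by (auto simp: in_keys_iff lookup_add)
  ultimately show "Poly_Mapping.keys m \<subseteq> {1..N}" by blast
qed

lemma vf_apply_poly_ring:
  assumes "X \<in> witt_alg N" "p \<in> poly_ring N"
  shows "vf_apply N X p \<in> poly_ring N"
  using assms unfolding vf_apply_def witt_alg_def
  by (auto intro!: poly_ring_sum poly_ring_mult poly_ring_pd)

lemma lie_algebra_witt_alg: "lie_algebra N (witt_alg N)"
  unfolding lie_algebra_def
proof (intro conjI ballI subset_refl)
  show "vf.subspace (witt_alg N :: 'a vfield set)"
    by (auto simp: vf.subspace_def witt_alg_def vf_scale_def
        intro!: poly_ring_zero poly_ring_add poly_ring_mult poly_ring_const)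
  fix X Y :: "'a vfield" assume "X \<in> witt_alg N" "Y \<in> witt_alg N"
  then show "vf_bracket N X Y \<in> witt_alg N"
    by (auto simp: witt_alg_def vf_bracket_def vf_apply_def
        intro!: poly_ring_diff poly_ring_sum poly_ring_mult poly_ring_pd)
qed

text \<open>In two variables every divergence-free field is Hamiltonian: the condition
  \<open>\<partial>f\<^sub>1/\<partial>x\<^sub>1 + \<partial>f\<^sub>2/\<partial>x\<^sub>2 = 0\<close> makes the closed one-form
  \<open>f\<^sub>2 dx\<^sub>1 - f\<^sub>1 dx\<^sub>2\<close> exact. So the inclusion of \<open>hamiltonian_alg n\<close> in
  \<open>special_alg (2 * n)\<close> cannot be strict for \<open>n = 1\<close>.\<close>

lemma special_alg_2_le_hamiltonian_alg_1:
  "(special_alg (2 * 1) :: 'a::field_char_0 vfield set) \<subseteq> hamiltonian_alg 1"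
proof
  fix X :: "'a vfield" assume "X \<in> special_alg (2 * 1)"
  then have XW: "X \<in> witt_alg 2" and div: "pd 1 (X 1) + pd 2 (X 2) = 0"
    by (auto simp: special_alg_def numeral_2_eq_2)
  let ?e = "\<lambda>i. Poly_Mapping.single i (1::nat) :: nat \<Rightarrow>\<^sub>0 nat"
  let ?lk = "Poly_Mapping.lookup"
  have sub: "m - ?e i + ?e i = m" if "?lk m i \<noteq> 0" for m i
    using that by (intro poly_mapping_eqI) (auto simp: lookup_add lookup_minus lookup_single when_def)
  define A where "A = Poly_Mapping.keys (X 2)"
  define B where "B = {m \<in> Poly_Mapping.keys (X 1). ?lk m 1 = 0}"
  define u where "u =
    (\<Sum>m\<in>A. Poly_Mapping.single (m + ?e 1) (?lk (X 2) m / of_nat (?lk m 1 + 1))) -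
    (\<Sum>m\<in>B. Poly_Mapping.single (m + ?e 2) (?lk (X 1) m / of_nat (?lk m 2 + 1)))"
  have fin: "finite A" "finite B" by (simp_all add: A_def B_def)
  have u: "?lk u x =
      (\<Sum>m\<in>A. if m + ?e 1 = x then ?lk (X 2) m / of_nat (?lk m 1 + 1) else 0) -
      (\<Sum>m\<in>B. if m + ?e 2 = x then ?lk (X 1) m / of_nat (?lk m 2 + 1) else 0)" for x
    unfolding u_def lookup_minus lookup_sum lookup_single when_def by (rule refl)
  have neq: "m + ?e 2 \<noteq> k + ?e 1" if "?lk m 1 = 0" for m k
  proof
    assume "m + ?e 2 = k + ?e 1"
    then have "?lk (m + ?e 2) 1 = ?lk (k + ?e 1) 1" by (rule arg_cong)
    then show False using that by (simp add: lookup_add lookup_single)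
  qed
  have u1: "?lk u (k + ?e 1) = ?lk (X 2) k / of_nat (?lk k 1 + 1)" for k
  proof -
    have "(\<Sum>m\<in>B. if m + ?e 2 = k + ?e 1 then ?lk (X 1) m / of_nat (?lk m 2 + 1) else 0) = 0"
      by (intro sum.neutral ballI if_not_P neq) (simp add: B_def)
    moreover have "(\<Sum>m\<in>A. if m + ?e 1 = k + ?e 1 then ?lk (X 2) m / of_nat (?lk m 1 + 1) else 0) =
        (if k \<in> A then ?lk (X 2) k / of_nat (?lk k 1 + 1) else 0)"
      unfolding add_right_cancel by (rule sum.delta[OF fin(1)])
    ultimately show ?thesis
      unfolding u by (simp add: A_def in_keys_iff)
  qed
  have u2: "?lk u (k + ?e 2) = - ?lk (X 1) k / of_nat (?lk k 2 + 1)" if k: "?lk k 1 = 0" for k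
  proof -
    have "(\<Sum>m\<in>A. if m + ?e 1 = k + ?e 2 then ?lk (X 2) m / of_nat (?lk m 1 + 1) else 0) = 0"
      by (intro sum.neutral ballI if_not_P neq[OF k, symmetric])
    moreover have "(\<Sum>m\<in>B. if m + ?e 2 = k + ?e 2 then ?lk (X 1) m / of_nat (?lk m 2 + 1) else 0) =
        (if k \<in> B then ?lk (X 1) k / of_nat (?lk k 2 + 1) else 0)"
      unfolding add_right_cancel by (rule sum.delta[OF fin(2)])
    ultimately show ?thesis
      unfolding u using k by (simp add: B_def in_keys_iff)
  qed
  have nz: "of_nat (k + 1) \<noteq> (0::'a)" for k
    by (metis Suc_eq_plus1 of_nat_neq_0)
  have d1: "pd 1 u = X 2"
    by (rule poly_mapping_eqI) (simp only: lookup_pd u1 nz nonzero_mult_div_cancel_left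
        times_divide_eq_right not_False_eq_True)
  have d2: "pd 2 u = - X 1"
  proof (rule poly_mapping_eqI)
    fix k
    show "?lk (pd 2 u) k = ?lk (- X 1) k"
    proof (cases "?lk k 1 = 0")
      case True
      then show ?thesis
        by (simp only: lookup_pd u2 nz nonzero_mult_div_cancel_left
            times_divide_eq_right not_False_eq_True lookup_uminus)
    next
      case False
      define j where "j = k - ?e 1"
      have k: "k = j + ?e 1" unfolding j_def using sub[OF False] by simp
      have "?lk (pd 1 (X 1) + pd 2 (X 2)) j = 0" by (simp only: div lookup_zero)
      then have dj: "of_nat (?lk j 2 + 1) * ?lk (X 2) (j + ?e 2) = - (of_nat (?lk j 1 + 1) * ?lk (X 1) k)"
        by (simp only: lookup_add lookup_pd k) (metis add.commute add_eq_0_iff)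
      have j2: "?lk k 2 = ?lk j 2" "?lk (j + ?e 2) 1 = ?lk j 1"
        by (simp_all add: k lookup_add lookup_single)
      have "?lk (pd 2 u) k = of_nat (?lk j 2 + 1) * ?lk u ((j + ?e 2) + ?e 1)"
        by (simp only: lookup_pd j2) (simp only: k ac_simps)
      also have "\<dots> = of_nat (?lk j 2 + 1) * ?lk (X 2) (j + ?e 2) / of_nat (?lk j 1 + 1)"
        by (simp only: u1 j2 times_divide_eq_right)
      also have "\<dots> = - ?lk (X 1) k"
        by (simp only: dj minus_divide_left[symmetric] nz nonzero_mult_div_cancel_left not_False_eq_True)
      finally show ?thesis by simp
    qed
  qed
  have X: "X i \<in> poly_ring 2" "i \<notin> {1..2} \<Longrightarrow> X i = 0" for i
    using XW by (auto simp: witt_alg_def)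
  have "u \<in> poly_ring 2"
    unfolding u_def
  proof (intro poly_ring_diff poly_ring_sum)
    fix m assume "m \<in> A"
    then have "Poly_Mapping.keys m \<subseteq> {1..2}" using X(1)[of 2] by (auto simp: poly_ring_def A_def)
    then show "Poly_Mapping.single (m + ?e 1) (?lk (X 2) m / of_nat (?lk m 1 + 1)) \<in> poly_ring 2"
      using keys_add[of m "?e 1"] by (fastforce simp: poly_ring_def)
  next
    fix m assume "m \<in> B"
    then have "Poly_Mapping.keys m \<subseteq> {1..2}" using X(1)[of 1] by (auto simp: poly_ring_def B_def)
    then show "Poly_Mapping.single (m + ?e 2) (?lk (X 1) m / of_nat (?lk m 2 + 1)) \<in> poly_ring 2"
      using keys_add[of m "?e 2"] by (fastforce simp: poly_ring_def)
  qed
  moreover have "X = ham_field 1 u"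
  proof
    fix i :: nat
    consider "i = 1" | "i = 2" | "i \<notin> {1..2}" by fastforce
    then show "X i = ham_field 1 u i"
    proof cases
      case 1
      have "ham_field 1 u i = - pd (1 + 1) u" by (simp add: ham_field_def 1)
      then show ?thesis using d2 1 by (simp add: numeral_2_eq_2)
    next
      case 2
      have "ham_field 1 u i = pd 1 u" by (simp add: ham_field_def 2)
      then show ?thesis using d1 2 by simp
    next
      case 3
      then show ?thesis using X(2)[OF 3] by (auto simp: ham_field_def)
    qed
  qed
  ultimately have "X \<in> ham_field 1 ` poly_ring (2 * 1)" by simp
  then show "X \<in> hamiltonian_alg 1"
    unfolding hamiltonian_alg_def by (rule hull_inc)
qed

end

theory Submission
  imports Defs
begin

text \<open>The inclusion rests on the fact that the Hamiltonian fields already form a Lie algebra, so that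
  the generated algebra contains nothing else (\<open>hamiltonian_alg_eq\<close>). Write \<open>H\<^sub>u\<close> for the field of
  \<open>u\<close>. The Poisson bracket \<open>H\<^sub>u(v)\<close> is antisymmetric in \<open>u\<close> and \<open>v\<close>, and differentiation acts on it as
  a derivation; together these say \<open>[H\<^sub>u, H\<^sub>v] = H\<^bsub>H\<^sub>u(v)\<^esub>\<close> (\<open>vf_bracket_ham_field\<close>). A Hamiltonian
  field has divergence zero because its mixed second derivatives cancel in pairs, and the
  divergence-free fields are closed under the bracket because
  \<open>div [X, Y] = X(div Y) - Y(div X)\<close> (\<open>vf_div_bracket\<close>).

  For strictness when \<open>n \<ge> 2\<close>, take the divergence-free field \<open>x\<^sub>1 \<partial>/\<partial>x\<^sub>2\<close>. If it were \<open>H\<^sub>u\<close>, then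
  \<open>\<partial>u/\<partial>x\<^sub>1 = 0\<close> and \<open>\<partial>u/\<partial>x\<^bsub>n+2\<^esub> = -x\<^sub>1\<close>, and the mixed derivative of \<open>u\<close> in these two variables would
  be both \<open>0\<close> and \<open>-1\<close>. For \<open>n = 1\<close> the variable \<open>x\<^sub>2\<close> is the one conjugate to \<open>x\<^sub>1\<close>, so this argument
  breaks down, as it must: there the two algebras agree.\<close>

section \<open>Partial derivatives and derivations\<close>

lemma pd_uminus: "pd i (- p) = - pd i p"
  using pd_diff[of i 0 p] by simp

lemma pd_const_mult: "pd i (Poly_Mapping.single 0 c * p) = Poly_Mapping.single 0 c * pd i p"
  by (simp add: pd_mult pd_single)

lemma poly_ring_uminus: "p \<in> poly_ring N \<Longrightarrow> - p \<in> poly_ring N"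
  using poly_ring_diff[OF poly_ring_zero, of p N] by simp

lemma pd_vf_apply:
  "pd k (vf_apply N X p) = vf_apply N (\<lambda>i. pd k (X i)) p + vf_apply N X (pd k p)"
  by (simp add: vf_apply_def pd_sum pd_mult sum.distrib pd_commute[of k])

lemma vf_apply_uminus: "vf_apply N X (- p) = - vf_apply N X p"
  by (simp add: vf_apply_def pd_uminus sum_negf)

lemma vf_apply_zero [simp]: "vf_apply N X 0 = 0"
  by (simp add: vf_apply_def)

lemma vf_apply_sum: "vf_apply N X (\<Sum>j\<in>A. f j) = (\<Sum>j\<in>A. vf_apply N X (f j))"
  unfolding vf_apply_def pd_sum sum_distrib_left by (rule sum.swap)

section \<open>Divergence-free fields\<close>

definition vf_div :: "nat \<Rightarrow> 'a::comm_ring_1 vfield \<Rightarrow> 'a mpoly"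
  where "vf_div N X = (\<Sum>i = 1..N. pd i (X i))"

text \<open>The cross terms \<open>\<partial>\<^sub>j X\<^sub>i \<partial>\<^sub>i Y\<^sub>j\<close>, summed over both indices, form the trace of a product
  of Jacobians; it is symmetric in \<open>X\<close> and \<open>Y\<close> and therefore disappears from the commutator.\<close>

lemma vf_div_bracket:
  "vf_div N (vf_bracket N X Y) = vf_apply N X (vf_div N Y) - vf_apply N Y (vf_div N X)"
proof -
  define T where "T X Y = (\<Sum>j = 1..N. vf_apply N (\<lambda>i. pd j (X i)) (Y j))" for X Y :: "'a vfield"
  have "T X Y = T Y X"
    unfolding T_def vf_apply_def by (subst sum.swap) (simp add: mult.commute)
  moreover have "vf_div N (vf_bracket N X Y) =
      (T X Y + vf_apply N X (vf_div N Y)) - (T Y X + vf_apply N Y (vf_div N X))"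
    by (simp add: vf_div_def vf_bracket_def pd_diff pd_vf_apply T_def sum.distrib sum_subtractf vf_apply_sum)
  ultimately show ?thesis by simp
qed

lemma special_alg_altdef: "special_alg N = {X \<in> witt_alg N. vf_div N X = 0}"
  by (simp add: special_alg_def vf_div_def)

lemma lie_algebra_special_alg: "lie_algebra N (special_alg N :: 'a::field vfield set)"
proof -
  have W: "vf.subspace (witt_alg N :: 'a vfield set)"
    "\<And>X Y :: 'a vfield. X \<in> witt_alg N \<Longrightarrow> Y \<in> witt_alg N \<Longrightarrow> vf_bracket N X Y \<in> witt_alg N"
    using lie_algebra_witt_alg[of N] by (auto simp: lie_algebra_def)
  have "vf_div N 0 = (0 :: 'a mpoly)"
    by (simp add: vf_div_def)
  moreover have "vf_div N (X + Y) = vf_div N X + vf_div N Y" for X Y :: "'a vfield"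
    by (simp add: vf_div_def pd_add sum.distrib)
  moreover have "vf_div N (vf_scale c X) = Poly_Mapping.single 0 c * vf_div N X" for c and X :: "'a vfield"
    by (simp add: vf_div_def vf_scale_def pd_const_mult sum_distrib_left)
  ultimately show ?thesis
    using W unfolding lie_algebra_def special_alg_altdef vf.subspace_def
    by (auto simp: vf_div_bracket)
qed

section \<open>Hamiltonian fields\<close>

lemma sum_conjugate_pairs:
  fixes g :: "nat \<Rightarrow> 'b::comm_monoid_add"
  shows "(\<Sum>i = 1..2*n. g i) = (\<Sum>i = 1..n. g i + g (n + i))"
proof -
  have "(\<Sum>i = 1..2*n. g i) = (\<Sum>i = 1..n. g i) + (\<Sum>i = n+1..n+n. g i)"
    unfolding mult_2 by (rule sum.ub_add_nat) simp
  also have "(\<Sum>i = n+1..n+n. g i) = (\<Sum>i = 1..n. g (n + i))"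
    using sum.shift_bounds_cl_nat_ivl[of g 1 n n] by (simp add: add.commute)
  finally show ?thesis by (simp add: sum.distrib)
qed

lemma ham_field_lower: "i \<in> {1..n} \<Longrightarrow> ham_field n u i = - pd (n + i) u"
  and ham_field_upper: "i \<in> {1..n} \<Longrightarrow> ham_field n u (n + i) = pd i u"
  by (auto simp: ham_field_def)

lemma vf_apply_ham_field:
  "vf_apply (2*n) (ham_field n u) v =
    (\<Sum>i = 1..n. pd i u * pd (n + i) v - pd (n + i) u * pd i v)"
  unfolding vf_apply_def sum_conjugate_pairs
  by (intro sum.cong refl) (simp add: ham_field_lower ham_field_upper)

lemma poisson_antisym:
  "vf_apply (2*n) (ham_field n v) u = - vf_apply (2*n) (ham_field n u) v"
  unfolding vf_apply_ham_field sum_negf[symmetric]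
  by (intro sum.cong refl) (simp add: mult.commute)

lemma pd_ham_field: "pd k (ham_field n u i) = ham_field n (pd k u) i"
  by (simp add: ham_field_def pd_uminus pd_commute[of k])

lemma pd_poisson:
  "pd k (vf_apply (2*n) (ham_field n u) v) =
    vf_apply (2*n) (ham_field n u) (pd k v) - vf_apply (2*n) (ham_field n v) (pd k u)"
  using poisson_antisym[of n v "pd k u"]
  by (simp add: pd_vf_apply pd_ham_field)

text \<open>Each coordinate of a Hamiltonian field is, up to sign, a partial derivative of its
  Hamiltonian, so coordinatewise this is the derivative of the Poisson bracket.\<close>

lemma vf_bracket_ham_field:
  "vf_bracket (2*n) (ham_field n u) (ham_field n v) =
    ham_field n (vf_apply (2*n) (ham_field n u) v)"
proof
  fix j
  show "vf_bracket (2*n) (ham_field n u) (ham_field n v) j =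
      ham_field n (vf_apply (2*n) (ham_field n u) v) j"
    unfolding vf_bracket_def fun_cong[OF ham_field_def, of _ _ j]
    by (simp add: pd_poisson vf_apply_uminus)
qed

lemma ham_field_in_witt_alg: "u \<in> poly_ring (2*n) \<Longrightarrow> ham_field n u \<in> witt_alg (2*n)"
  by (auto simp: witt_alg_def ham_field_def intro: poly_ring_uminus poly_ring_pd poly_ring_zero)

lemma vf_div_ham_field: "vf_div (2*n) (ham_field n u) = 0"
  unfolding vf_div_def sum_conjugate_pairs
  by (intro sum.neutral ballI) (simp add: ham_field_lower ham_field_upper pd_uminus pd_commute)

lemma lie_algebra_ham_fields:
  "lie_algebra (2*n) (ham_field n ` poly_ring (2*n) :: 'a::field vfield set)"
proof -
  have "ham_field n 0 = (0 :: 'a vfield)"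
    by (simp add: fun_eq_iff ham_field_def)
  moreover have "ham_field n u + ham_field n v = ham_field n (u + v)" for u v :: "'a mpoly"
    by (simp add: fun_eq_iff ham_field_def pd_add)
  moreover have "vf_scale c (ham_field n u) = ham_field n (Poly_Mapping.single 0 c * u)"
    for c and u :: "'a mpoly"
    by (simp add: fun_eq_iff vf_scale_def ham_field_def pd_const_mult)
  ultimately have "vf.subspace (ham_field n ` poly_ring (2*n) :: 'a vfield set)"
    unfolding vf.subspace_def
    by (auto intro!: imageI poly_ring_add poly_ring_mult poly_ring_const)
       (metis imageI poly_ring_zero)
  then show ?thesis
    unfolding lie_algebra_def
    by (auto simp: vf_bracket_ham_field
        intro!: imageI ham_field_in_witt_alg vf_apply_poly_ring)
qed

lemma hamiltonian_alg_eq: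
  "(hamiltonian_alg n :: 'a::field vfield set) = ham_field n ` poly_ring (2*n)"
  unfolding hamiltonian_alg_def
  by (rule hull_same)
     (auto simp: lie_subalgebra_def lie_algebra_ham_fields lie_algebra_witt_alg
       intro: ham_field_in_witt_alg)

section \<open>A divergence-free field that is not Hamiltonian\<close>

definition shear_field :: "'a::comm_ring_1 vfield"
  where "shear_field = (\<lambda>i. if i = 2 then Poly_Mapping.single (Poly_Mapping.single 1 1) 1 else 0)"

lemma shear_field_in_special_alg:
  assumes "N \<ge> 2"
  shows "shear_field \<in> special_alg N"
proof -
  have "Poly_Mapping.single (Poly_Mapping.single 1 1) 1 \<in> poly_ring N"
    using assms by (auto simp: poly_ring_def)
  then have "shear_field \<in> witt_alg N"
    using assms by (auto simp: witt_alg_def shear_field_def poly_ring_zero)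
  moreover have "vf_div N shear_field = 0"
    unfolding vf_div_def
    by (intro sum.neutral) (auto simp: shear_field_def pd_single lookup_single)
  ultimately show ?thesis by (simp add: special_alg_altdef)
qed

lemma shear_field_not_hamiltonian:
  assumes "n \<ge> 2"
  shows "(shear_field :: 'a::field vfield) \<notin> hamiltonian_alg n"
proof
  assume "(shear_field :: 'a vfield) \<in> hamiltonian_alg n"
  then obtain u :: "'a mpoly" where u: "shear_field = ham_field n u"
    unfolding hamiltonian_alg_eq by blast
  have "pd 1 u = ham_field n u (n + 1)"
    using assms by (simp add: ham_field_def)
  then have "pd (n + 2) (pd 1 u) = 0"
    using assms by (simp add: u[symmetric] shear_field_def)
  moreover have "pd (n + 2) u = - ham_field n u 2"
    using assms by (simp add: ham_field_def)
  then have "pd 1 (pd (n + 2) u) = - 1"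
    by (simp add: u[symmetric] shear_field_def pd_uminus pd_single)
  ultimately show False
    by (simp add: pd_commute)
qed

section \<open>Proper inclusion\<close>

theorem mainTheorem3:
  fixes n :: nat
  assumes "n \<ge> 1"
  shows "lie_subalgebra (2 * n) (hamiltonian_alg n :: 'a::field_char_0 vfield set) (special_alg (2 * n))
    \<and> (n \<ge> 2 \<longrightarrow> (hamiltonian_alg n :: 'a vfield set) \<noteq> special_alg (2 * n))"
proof (intro conjI impI)
  show "lie_subalgebra (2 * n) (hamiltonian_alg n :: 'a vfield set) (special_alg (2 * n))"
    unfolding lie_subalgebra_def hamiltonian_alg_eq
  proof (intro conjI lie_algebra_ham_fields lie_algebra_special_alg)
    show "ham_field n ` poly_ring (2 * n) \<subseteq> (special_alg (2 * n) :: 'a vfield set)"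
      by (auto simp: special_alg_altdef ham_field_in_witt_alg vf_div_ham_field)
  qed
  assume "n \<ge> 2"
  then show "(hamiltonian_alg n :: 'a vfield set) \<noteq> special_alg (2 * n)"
    using shear_field_not_hamiltonian shear_field_in_special_alg[of "2 * n"] by fastforce
qed

end
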